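(* Let $X$ be a set, $Y$ a finite set, and $\mathcal{H}$ a non-empty set of functions $X\to 2^Y$ such that for every $h\in\mathcal{H}$ there is $x\in X$ with $h(x)\neq\emptyset$. If $\mathrm{AL}(\mathcal{H})=\infty$ (i.e. ambiguous shattered $\mathcal{H}$-trees have unbounded rank), then for all $N\in\mathbb{N}$, $\mathcal{M}^*_{\mathcal{H}}(N)\ge\lfloor\sqrt{N}\rfloor$.
   Context: Conventions: $0\in\mathbb{N}$; $\Sigma^*$ is the set of finite words over $\Sigma$; for a word $w$, $w_k$ is its $k$-th symbol (starting from $0$) and $w_{:k}$ its prefix of length $k$. For $xy\in(X\times Y)^n$, $x\in X^n$ and $y\in Y^n$ denote its projections. Mistakes. A (deterministic) learner is a map $A:(X\times Y)^*\times X\to 2^Y$. For $h:X\to 2^Y$ and $xy\in(X\times Y)^n$, put $\mathcal{M}^A_h(xy):=\{k<n\mid y_k\notin A(xy_{:k},x_k)\text{ or }A(xy_{:k},x_k)\not\subseteq h(x_k)\}$. Let $\mathcal{C}_h(n)$ be the set of $xy\in(X\times Y)^n$ with $y_k\in h(x_k)$ for all $k<n$. Define $\mathcal{M}^A_h(N):=\max_{xy\in\mathcal{C}_h(N)}|\mathcal{M}^A_h(xy)|$, $\mathcal{M}^A_{\mathcal{H}}(N):=\max_{h\in\mathcal{H}}\mathcal{M}^A_h(N)$, $\mathcal{M}^*_{\mathcal{H}}(N):=\min_A\mathcal{M}^A_{\mathcal{H}}(N)$. Trees. A rooted tree is $(V,v_0,P)$ with $V$ a finite set, $v_0\in V$ (root),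 and $P:V\setminus\{v_0\}\to V$ (parent) such that for each $v\in V$ there is $k\in\mathbb{N}$ with $P^k(v)=v_0$. Write $E:=V\setminus\{v_0\}$, $V_f:=V\setminus P(E)$ (leaves), $V_p:=V\setminus V_f$, and $P^*(v):=\{v,P(v),P^2(v),\dots\}$. An ambiguous shattered $\mathcal{H}$-tree is $T=(V,v_0,P,\mathbf{x},\mathbf{y},\mathbf{h},E_0)$ with $(V,v_0,P)$ a rooted tree, $\mathbf{x}:V_p\to X$, $\mathbf{y}:E\to Y$, $\mathbf{h}:V_f\to\mathcal{H}$ (written with subscripts) and $E_0\subseteq E$ such that: (i) for every $v\in V_p$, $|P^{-1}(v)\cap E_0|=1$; (ii) if $a\neq b$ in $E$ and $P(a)=P(b)$ then $\mathbf{y}_a\neq\mathbf{y}_b$; (iii) for every $u\in V_f$ and $a\in P^*(u)\setminus\{v_0\}$, $\mathbf{y}_a\in\mathbf{h}_u(\mathbf{x}_{P(a)})$. For $u\in V_f$, $R_T(u)$ is the set of $a\in P^*(u)\setminus\{v_0\}$ such that either $a\notin E_0$ or there is $b\in P^{-1}(P(a))$ with $\mathbf{y}_b\notin\mathbf{h}_u(\mathbf{x}_{P(a)})$. The rank of $T$ is $\min_{u\in V_f}|R_T(u)|$. The ambiguous Littlestone dimension $\mathrm{AL}(\mathcal{H})$ is the maximal rank of an ambiguous shattered $\mathcal{H}$-tree, or $\infty$ if the rank is unbounded. *)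

theory Defs
  imports Complex_Main "HOL-Library.Extended_Nat"
begin

section \<open>Learners and mistakes\<close>

text \<open>
  The sets \<open>X\<close> and \<open>Y\<close> are the types \<open>'x\<close> and \<open>'y\<close>; a hypothesis is a function \<open>'x \<Rightarrow> 'y set\<close>,
  and a word over \<open>X \<times> Y\<close> is a list of pairs.
\<close>

type_synonym ('x, 'y) learner = "('x \<times> 'y) list \<Rightarrow> 'x \<Rightarrow> 'y set"

definition mistake_set ::
    "('x, 'y) learner \<Rightarrow> ('x \<Rightarrow> 'y set) \<Rightarrow> ('x \<times> 'y) list \<Rightarrow> nat set" where
  "mistake_set A h xy =
     {k. k < length xy \<and>
         (snd (xy ! k) \<notin> A (take k xy) (fst (xy ! k)) \<or>
          \<not> A (take k xy) (fst (xy ! k)) \<subseteq> h (fst (xy ! k)))}"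

definition correct_words :: "('x \<Rightarrow> 'y set) \<Rightarrow> nat \<Rightarrow> ('x \<times> 'y) list set" where
  "correct_words h n =
     {xy. length xy = n \<and> (\<forall>k<n. snd (xy ! k) \<in> h (fst (xy ! k)))}"

text \<open>
  The cardinalities below are at most \<open>N\<close>, so each extremum is over a finite set of naturals,
  even when the index set is infinite. It is over a non-empty set whenever \<open>H\<close> is non-empty and
  every \<open>h \<in> H\<close> has some non-empty value; otherwise a maximum may be unspecified.
\<close>

definition mistakes_hyp :: "('x, 'y) learner \<Rightarrow> ('x \<Rightarrow> 'y set) \<Rightarrow> nat \<Rightarrow> nat" where
  "mistakes_hyp A h N = (MAX xy\<in>correct_words h N. card (mistake_set A h xy))"

definition mistakes_class :: "('x, 'y) learner \<Rightarrow> ('x \<Rightarrow> 'y set) set \<Rightarrow> nat \<Rightarrow> nat" where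
  "mistakes_class A H N = (MAX h\<in>H. mistakes_hyp A h N)"

definition optimal_mistakes :: "('x \<Rightarrow> 'y set) set \<Rightarrow> nat \<Rightarrow> nat" where
  "optimal_mistakes H N = (MIN A. mistakes_class A H N)"

section \<open>Rooted trees\<close>

text \<open>
  The parent map is a total function whose value at the root is irrelevant.
\<close>

record 'v rtree =
  verts :: "'v set"
  root :: 'v
  parent :: "'v \<Rightarrow> 'v"

definition edges :: "('v, 'm) rtree_scheme \<Rightarrow> 'v set" where
  "edges T = verts T - {root T}"

definition rooted_tree :: "('v, 'm) rtree_scheme \<Rightarrow> bool" where
  "rooted_tree T \<longleftrightarrow>
     finite (verts T) \<and> root T \<in> verts T \<and> parent T ` edges T \<subseteq> verts T \<and>
     (\<forall>v\<in>verts T. \<exists>k. (parent T ^^ k) v = root T)"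

definition leaves :: "('v, 'm) rtree_scheme \<Rightarrow> 'v set" where
  "leaves T = verts T - parent T ` edges T"

definition inner_verts :: "('v, 'm) rtree_scheme \<Rightarrow> 'v set" where
  "inner_verts T = verts T - leaves T"

definition children :: "('v, 'm) rtree_scheme \<Rightarrow> 'v \<Rightarrow> 'v set" where
  "children T v = {a \<in> edges T. parent T a = v}"

text \<open>
  The set \<open>{v, P v, P (P v), \<dots>}\<close>, ending at the root: the parent map is never applied to the root.
\<close>

definition ancestors :: "('v, 'm) rtree_scheme \<Rightarrow> 'v \<Rightarrow> 'v set" where
  "ancestors T v = {(parent T ^^ k) v |k. \<forall>j<k. (parent T ^^ j) v \<noteq> root T}"

section \<open>Ambiguous shattered trees\<close>

record ('v, 'x, 'y) amb_tree = "'v rtree" +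
  xlab :: "'v \<Rightarrow> 'x"
  ylab :: "'v \<Rightarrow> 'y"
  hlab :: "'v \<Rightarrow> 'x \<Rightarrow> 'y set"
  edges0 :: "'v set"

definition ambiguous_shattered ::
    "('x \<Rightarrow> 'y set) set \<Rightarrow> ('v, 'x, 'y) amb_tree \<Rightarrow> bool" where
  "ambiguous_shattered H T \<longleftrightarrow>
     rooted_tree T \<and>
     (\<forall>u\<in>leaves T. hlab T u \<in> H) \<and>
     edges0 T \<subseteq> edges T \<and>
     (\<forall>v\<in>inner_verts T. card (children T v \<inter> edges0 T) = 1) \<and>
     (\<forall>a\<in>edges T. \<forall>b\<in>edges T. a \<noteq> b \<and> parent T a = parent T b \<longrightarrow> ylab T a \<noteq> ylab T b) \<and>
     (\<forall>u\<in>leaves T. \<forall>a\<in>ancestors T u - {root T}.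
        ylab T a \<in> hlab T u (xlab T (parent T a)))"

definition rank_set :: "('v, 'x, 'y) amb_tree \<Rightarrow> 'v \<Rightarrow> 'v set" where
  "rank_set T u =
     {a \<in> ancestors T u - {root T}.
        a \<notin> edges0 T \<or>
        (\<exists>b\<in>children T (parent T a). ylab T b \<notin> hlab T u (xlab T (parent T a)))}"

definition tree_rank :: "('v, 'x, 'y) amb_tree \<Rightarrow> nat" where
  "tree_rank T = (MIN u\<in>leaves T. card (rank_set T u))"

text \<open>
  Every finite tree is isomorphic to one with vertices in \<open>nat\<close>, so restricting the vertex type
  loses nothing. For non-empty \<open>H\<close> the one-vertex tree shows that the set of ranks is non-empty;
  the supremum is then its maximum if it is bounded, and \<open>\<infinity>\<close> otherwise.
\<close>

definition AL :: "('x \<Rightarrow> 'y set) set \<Rightarrow> enat" where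
  "AL H = Sup {enat (tree_rank T) |T :: (nat, 'x, 'y) amb_tree. ambiguous_shattered H T}"

end

theory Submission
  imports Defs
begin

text \<open>
  Let \<open>y\<close> be big at \<open>x\<close> if the hypotheses with \<open>y \<in> h x\<close> still shatter a tree of large
  rank. In a tree of larger rank, always descend along the edges in \<open>E\<^sub>0\<close> while all labels at a
  vertex are big: since the rank is large, some hypothesis \<open>h\<close> and some point \<open>x\<close> have two big
  labels \<open>y \<in> h x\<close> and \<open>y' \<notin> h x\<close>. The property of having large rank survives finite
  partitions of the class (combine two learners by intersecting their predictions), hence either
  the class \<open>y \<in> h x, y' \<notin> h x\<close> or the class \<open>y, y' \<in> h x\<close> is large. In the first case one
  presentation of \<open>x\<close> forces a mistake. In the second case the adversary presents \<open>(x, y)\<close> for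
  as long as the learner predicts both labels: after \<open>d\<close> rounds the hypothesis \<open>h\<close> witnesses \<open>d\<close>
  mistakes, and if the learner omits a label before, that label is a certain mistake and the
  class \<open>y, y' \<in> h x\<close> remains. Thus \<open>d\<close> mistakes cost at most \<open>d\<^sup>2\<close> rounds.
\<close>

section \<open>Shattering with offsets\<close>

text \<open>
  The offset \<open>m h\<close> is the contribution to the rank of a leaf labelled \<open>h\<close> of the edges above
  the current vertex. It depends on \<open>h\<close> because an edge of \<open>E\<^sub>0\<close> counts for some leaves only.
\<close>

inductive shatters :: "nat \<Rightarrow> ('x \<Rightarrow> 'y set) set \<Rightarrow> (('x \<Rightarrow> 'y set) \<Rightarrow> nat) \<Rightarrow> bool"
  for r where
  leaf: "shatters r H m" if "h \<in> H" "r \<le> m h"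
| node: "shatters r H m"
    if "y0 \<in> L"
      and "shatters r {h \<in> H. y0 \<in> h x} (\<lambda>h. m h + of_bool (\<not> L \<subseteq> h x))"
      and "\<And>y. y \<in> L \<Longrightarrow> y \<noteq> y0 \<Longrightarrow> shatters r {h \<in> H. y \<in> h x} (\<lambda>h. Suc (m h))"

text \<open>The same tree works: extra hypotheses only widen the choice at the leaves, and offsets
  lower by at most \<open>c\<close> are paid for by the threshold.\<close>

lemma shatters_mono:
  assumes "shatters r H m" and "r' + c \<le> r" and "H \<subseteq> H'" and "\<And>h. h \<in> H \<Longrightarrow> m h \<le> m' h + c"
  shows "shatters r' H' m'"
  using assms
proof (induction arbitrary: H' m')
  case (leaf h H m)
  then show ?case by (intro shatters.leaf[of h]) force+
next
  case (node y0 L H x m)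
  show ?case
  proof (rule shatters.node[of y0 L _ _ x])
    show "y0 \<in> L" by fact
    show "shatters r' {h \<in> H'. y0 \<in> h x} (\<lambda>h. m' h + of_bool (\<not> L \<subseteq> h x))"
      using node.prems by (intro node.IH(1)) auto
    show "shatters r' {h \<in> H'. y \<in> h x} (\<lambda>h. Suc (m' h))" if "y \<in> L" "y \<noteq> y0" for y
      using node.prems that by (intro node.IH(2)[of y]) auto
  qed
qed

lemma shatters_nonempty: "shatters r H m \<Longrightarrow> H \<noteq> {}"
  by (induction rule: shatters.induct) auto

lemma shatters_0_iff: "shatters 0 H m \<longleftrightarrow> H \<noteq> {}"
  using shatters_nonempty shatters.leaf[of _ H 0 m] by auto

text \<open>An edge outside \<open>edges0\<close> adds one to every leaf below it, so threshold
  \<open>r - 1\<close> before counting it becomes \<open>r\<close> afterwards. The guard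
  \<open>r \<noteq> 0\<close> keeps the subtraction from truncating.\<close>

lemma shatters_node_of_pred:
  assumes "y0 \<in> L"
    and "shatters r {h \<in> H. y0 \<in> h x} (\<lambda>h. m h + of_bool (\<not> L \<subseteq> h x))"
    and "\<And>y. y \<in> L \<Longrightarrow> r \<noteq> 0 \<Longrightarrow> shatters (r - 1) {h \<in> H. y \<in> h x} m"
  shows "shatters r H m"
proof (cases "r = 0")
  case True
  then show ?thesis using assms(2) shatters_nonempty by (fastforce simp: shatters_0_iff)
next
  case False
  have "shatters r {h \<in> H. y \<in> h x} (\<lambda>h. Suc (m h))" if "y \<in> L" for y
  proof -
    have "shatters (r - 1) {h \<in> H. y \<in> h x} m" using assms(3) that False by simp
    then show ?thesis
    proof (induction)
      case (leaf h H m)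
      then show ?case by (intro shatters.leaf[of h]) auto
    next
      case (node y0 L H x m)
      then show ?case using shatters.node[of y0 L r H x "\<lambda>h. Suc (m h)"] by simp
    qed
  qed
  with assms(1,2) show ?thesis by (rule shatters.node)
qed

text \<open>
  At a vertex with point \<open>x\<close> and labels \<open>L\<close>, either the restriction to some label decreases the
  rank of one of the two classes, which pays for this edge, or the rank of the class containing the
  hypothesis does not change along the edge of \<open>E\<^sub>0\<close>.
\<close>

lemma shatters_Un:
  assumes "shatters r H m" and "H \<subseteq> H1 \<union> H2" and "r1 + r2 + c \<le> r"
    and "\<And>h. h \<in> H \<inter> H1 \<Longrightarrow> m h \<le> m1 h + c" and "\<And>h. h \<in> H \<inter> H2 \<Longrightarrow> m h \<le> m2 h + c"
  shows "shatters r1 H1 m1 \<or> shatters r2 H2 m2"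
  using assms
proof (induction arbitrary: H1 H2 r1 r2 c m1 m2)
  case (leaf h H m)
  then consider "h \<in> H1" "r1 \<le> m1 h" | "h \<in> H2" "r2 \<le> m2 h" by fastforce
  then show ?case by cases (auto intro: shatters.leaf)
next
  case (node y0 L H x m)
  let ?R = "\<lambda>K y. {h \<in> K. y \<in> h x}"
  \<comment> \<open>The edge adds at most one to \<open>m\<close> while \<open>m1\<close> and
    \<open>m2\<close> stay as they are, hence \<open>Suc c\<close>.\<close>
  have IH: "shatters s1 (?R H1 y) m1 \<or> shatters s2 (?R H2 y) m2"
    if "y \<in> L" "s1 + s2 + Suc c \<le> r" for y s1 s2
  proof (cases "y = y0")
    case True
    show ?thesis
      unfolding True using node.prems that(2) by (intro node.IH(1)[of _ _ _ _ "Suc c"]) force+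
  next
    case False
    with node.prems that show ?thesis by (intro node.IH(2)[of y _ _ _ _ "Suc c"]) auto
  qed
  show ?case
  proof (cases "\<exists>y\<in>L. (r1 \<noteq> 0 \<and> \<not> shatters (r1 - 1) (?R H1 y) m1)
                  \<or> (r2 \<noteq> 0 \<and> \<not> shatters (r2 - 1) (?R H2 y) m2)")
    case True
    then obtain y where y: "y \<in> L"
      and *: "(r1 \<noteq> 0 \<and> \<not> shatters (r1 - 1) (?R H1 y) m1)
            \<or> (r2 \<noteq> 0 \<and> \<not> shatters (r2 - 1) (?R H2 y) m2)" by blast
    from * show ?thesis
    proof
      assume 1: "r1 \<noteq> 0 \<and> \<not> shatters (r1 - 1) (?R H1 y) m1"
      then have "shatters r2 (?R H2 y) m2" using IH[OF y, of "r1 - 1" r2] node.prems(2) by auto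
      then show ?thesis using shatters_mono[of r2 _ m2 r2 0 H2 m2] by auto
    next
      assume 2: "r2 \<noteq> 0 \<and> \<not> shatters (r2 - 1) (?R H2 y) m2"
      then have "shatters r1 (?R H1 y) m1" using IH[OF y, of r1 "r2 - 1"] node.prems(2) by auto
      then show ?thesis using shatters_mono[of r1 _ m1 r1 0 H1 m1] by auto
    qed
  next
    case False
    \<comment> \<open>Along the edge to \<open>y0\<close> all three offsets grow equally, so
      \<open>c\<close>, \<open>r1\<close> and \<open>r2\<close> are kept.\<close>
    have "shatters r1 (?R H1 y0) (\<lambda>h. m1 h + of_bool (\<not> L \<subseteq> h x)) \<or>
          shatters r2 (?R H2 y0) (\<lambda>h. m2 h + of_bool (\<not> L \<subseteq> h x))"
      using node.prems by (intro node.IH(1)[of _ _ _ _ c]) auto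
    then show ?thesis
      using False node.hyps(1) shatters_node_of_pred[of y0 L _ _ x] by blast
  qed
qed

text \<open>Resetting a child's offset to 0 costs at most one, so every label in \<open>L\<close> is
  big. If no hypothesis containing \<open>y0\<close> at \<open>x\<close> omits a label of
  \<open>L\<close>, the offset stays 0 along the edge to \<open>y0\<close> and the descent goes on;
  it cannot end in a leaf, where \<open>r\<close> is at most the offset. \<open>H0\<close> stays
  fixed since bigness refers to the whole class.\<close>

lemma shatters_big_labels:
  assumes "shatters r H m" and "H \<subseteq> H0" and "\<And>h. h \<in> H \<Longrightarrow> m h = 0" and "s < r"
  shows "\<exists>h\<in>H0. \<exists>x y y'. y \<in> h x \<and> y' \<notin> h x \<and>
    shatters s {h \<in> H0. y \<in> h x} (\<lambda>_. 0) \<and> shatters s {h \<in> H0. y' \<in> h x} (\<lambda>_. 0)"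
  using assms
proof (induction)
  case (leaf h H m)
  then have "m h = 0" by blast
  with leaf show ?case by simp
next
  case (node y0 L H x m)
  let ?big = "\<lambda>y. shatters s {h \<in> H0. y \<in> h x} (\<lambda>_. 0)"
  have big: "?big y" if "y \<in> L" for y
  proof (cases "y = y0")
    case True
    show ?thesis
      unfolding True using node.prems by (intro shatters_mono[OF node.hyps(2), of _ 1]) auto
  next
    case False
    show ?thesis
      using node.prems that False by (intro shatters_mono[OF node.hyps(3)[of y], of _ 1]) auto
  qed
  show ?case
  proof (cases "\<exists>h\<in>H0. y0 \<in> h x \<and> \<not> L \<subseteq> h x")
    case True
    then show ?thesis using big node.hyps(1) by blast
  next
    case False
    then show ?thesis using node.prems by (intro node.IH(1)) auto
  qed
qed

section \<open>The adversary\<close>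

lemma finite_mistake_set [simp]: "finite (mistake_set A h w)"
  by (simp add: mistake_set_def)

lemma card_mistake_set_le: "card (mistake_set A h w) \<le> length w"
  using card_mono[of "{..<length w}" "mistake_set A h w"] by (auto simp: mistake_set_def)

lemma card_mistake_set_append:
  "card (mistake_set A h (u @ v)) =
     card (mistake_set A h u) + card (mistake_set (\<lambda>w. A (u @ w)) h v)"
proof -
  let ?M = "mistake_set (\<lambda>w. A (u @ w)) h v"
  have "mistake_set A h (u @ v) = mistake_set A h u \<union> (+) (length u) ` ?M" (is "?l = ?r")
  proof (intro set_eqI iffI)
    fix k assume k: "k \<in> ?l"
    show "k \<in> ?r"
    proof (cases "k < length u")
      case True
      with k show ?thesis by (auto simp: mistake_set_def nth_append)
    next
      case False
      then have "k = length u + (k - length u)" by simp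
      moreover have "k - length u \<in> ?M" using k False by (auto simp: mistake_set_def nth_append)
      ultimately show ?thesis by blast
    qed
  qed (auto simp: mistake_set_def nth_append)
  moreover have "mistake_set A h u \<inter> (+) (length u) ` ?M = {}"
    by (auto simp: mistake_set_def)
  ultimately show ?thesis by (simp add: card_Un_disjoint card_image)
qed

definition consistent :: "('x \<Rightarrow> 'y set) \<Rightarrow> ('x \<times> 'y) list \<Rightarrow> bool" where
  "consistent h w \<longleftrightarrow> (\<forall>(x, y)\<in>set w. y \<in> h x)"

lemma correct_words_iff: "w \<in> correct_words h n \<longleftrightarrow> length w = n \<and> consistent h w"
  unfolding correct_words_def consistent_def
  by (auto simp: all_set_conv_all_nth split_beta)

text \<open>\<open>n\<close> only bounds the length, so the adversary may stop early; words are
  padded to full length at the end.\<close>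

definition forces :: "nat \<Rightarrow> nat \<Rightarrow> ('x, 'y) learner \<Rightarrow> ('x \<Rightarrow> 'y set) set \<Rightarrow> bool" where
  "forces n d A H \<longleftrightarrow>
     (\<exists>h\<in>H. \<exists>w. length w \<le> n \<and> consistent h w \<and> d \<le> card (mistake_set A h w))"

lemma forces_append:
  assumes "forces n d (\<lambda>w. A (u @ w)) K" and "K \<subseteq> H"
    and "\<And>h. h \<in> K \<Longrightarrow> consistent h u \<and> e \<le> card (mistake_set A h u)"
    and "length u + n \<le> n'" and "d' \<le> d + e"
  shows "forces n' d' A H"
proof -
  from assms(1) obtain h w where "h \<in> K" "length w \<le> n" "consistent h w"
    "d \<le> card (mistake_set (\<lambda>w. A (u @ w)) h w)" unfolding forces_def by blast
  with assms(2-5) show ?thesis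
    unfolding forces_def
    by (intro bexI[of _ h] exI[of _ "u @ w"])
       (fastforce simp: card_mistake_set_append consistent_def)+
qed

lemma card_mistake_set_snoc_mistake:
  assumes "y \<notin> A u x \<or> \<not> A u x \<subseteq> h x"
  shows "1 \<le> card (mistake_set A h (u @ [(x, y)]))"
proof -
  have "length u \<in> mistake_set A h (u @ [(x, y)])" using assms by (auto simp: mistake_set_def)
  then show ?thesis by (auto simp: Suc_le_eq card_gt_0_iff)
qed

text \<open>The thresholds solve \<open>s' = 2 * s + 1\<close>: one is lost in
  \<open>shatters_big_labels\<close>, and \<open>shatters_Un\<close> halves the rest. One more
  mistake takes at most \<open>d + 1\<close> rounds, and
  \<open>d * d + d + 1 \<le> Suc d * Suc d\<close>.\<close>

lemma shatters_imp_forces: "shatters (2 ^ d - 1) H (\<lambda>_. 0) \<Longrightarrow> forces (d * d) d A H"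
proof (induction d arbitrary: A H)
  case 0
  then obtain h where "h \<in> H" using shatters_nonempty[OF 0] by blast
  then show ?case by (auto simp: forces_def consistent_def)
next
  case (Suc d)
  let ?s = "2 ^ d - 1 :: nat"
  let ?R = "\<lambda>Q. {h \<in> H. Q h}"
  have "2 * ?s < 2 ^ Suc d - 1"
    using one_le_power[of "2 :: nat" d] unfolding power_Suc by linarith
  from shatters_big_labels[OF Suc.prems order_refl _ this]
  obtain h x y y' where h: "h \<in> H" "y \<in> h x" "y' \<notin> h x"
    and big: "shatters (2 * ?s) (?R (\<lambda>h. y \<in> h x)) (\<lambda>_. 0)"
    and big': "shatters (2 * ?s) (?R (\<lambda>h. y' \<in> h x)) (\<lambda>_. 0)"
    by auto
  \<comment> \<open>An opening whose last round is a mistake for all of \<open>K\<close>; mistakes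
    in the first \<open>j\<close> rounds are not counted.\<close>
  have step: "forces (Suc d * Suc d) (Suc d) A H"
    if "shatters ?s K (\<lambda>_. 0)" "K \<subseteq> H" "j \<le> d"
      "\<And>h. h \<in> K \<Longrightarrow> consistent h (replicate j (x, y) @ [(x, z)])"
      "\<And>h. h \<in> K \<Longrightarrow> z \<notin> A (replicate j (x, y)) x \<or> \<not> A (replicate j (x, y)) x \<subseteq> h x" for K j z
    by (rule forces_append[OF Suc.IH[OF that(1)] that(2),
          where u = "replicate j (x, y) @ [(x, z)]" and e = 1])
       (use that(3-5) in
         \<open>auto intro!: card_mistake_set_snoc_mistake simp del: One_nat_def\<close>)
  have "shatters ?s (?R (\<lambda>h. y \<in> h x \<and> y' \<notin> h x)) (\<lambda>_. 0) \<or>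
        shatters ?s (?R (\<lambda>h. y \<in> h x \<and> y' \<in> h x)) (\<lambda>_. 0)"
    by (rule shatters_Un[OF big, of _ _ _ _ 0]) auto
  then show ?case
  proof
    assume K: "shatters ?s (?R (\<lambda>h. y \<in> h x \<and> y' \<notin> h x)) (\<lambda>_. 0)"
    have K': "shatters ?s (?R (\<lambda>h. y' \<in> h x)) (\<lambda>_. 0)"
      by (rule shatters_mono[OF big', of _ 0]) auto
    \<comment> \<open>Predicting \<open>y'\<close> is wrong for every hypothesis in the class of
      \<open>K\<close>; otherwise presenting \<open>y'\<close> itself exposes the omission, and the
      class of \<open>K'\<close> remains.\<close>
    show ?thesis
    proof (cases "y' \<in> A [] x")
      case True
      show ?thesis by (rule step[OF K, of 0 y]) (use True in \<open>auto simp: consistent_def\<close>)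
    next
      case False
      show ?thesis by (rule step[OF K', of 0 y']) (use False in \<open>auto simp: consistent_def\<close>)
    qed
  next
    assume K: "shatters ?s (?R (\<lambda>h. y \<in> h x \<and> y' \<in> h x)) (\<lambda>_. 0)"
    show ?thesis
    proof (cases "\<exists>j\<le>d. \<exists>z\<in>{y, y'}. z \<notin> A (replicate j (x, y)) x")
      case True
      then obtain j z where "j \<le> d" "z \<in> {y, y'}" "z \<notin> A (replicate j (x, y)) x" by blast
      then show ?thesis by (intro step[OF K, of j z]) (auto simp: consistent_def)
    next
      case False
      let ?w = "replicate (Suc d) (x, y)"
      \<comment> \<open>Here the learner predicts \<open>y'\<close> in each of the
        \<open>d + 1\<close> rounds, although \<open>y' \<notin> h x\<close>; the single
        \<open>h\<close> suffices.\<close>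
      have mistake: "\<not> A (replicate j (x, y)) x \<subseteq> h x" if "j \<le> d" for j
        using False h that by blast
      have "mistake_set A h ?w = {..<Suc d}"
        using mistake by (auto simp: mistake_set_def min_def less_Suc_eq_le simp del: replicate_Suc)
      then have "card (mistake_set A h ?w) = Suc d" by simp
      with h show ?thesis
        unfolding forces_def consistent_def by (intro bexI[of _ h] exI[of _ ?w]) auto
    qed
  qed
qed

section \<open>From trees to shattering\<close>

context
  fixes T :: "('v, 'x, 'y) amb_tree"
  assumes tree: "rooted_tree T"
begin

text \<open>The first arrival at the root: further iterates of the total parent map may leave it
  again.\<close>

definition depth :: "'v \<Rightarrow> nat" where
  "depth v = (LEAST k. (parent T ^^ k) v = root T)"

lemma parent_in_verts: "a \<in> edges T \<Longrightarrow> parent T a \<in> verts T"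
  using tree unfolding rooted_tree_def by blast

lemma depth_edge:
  assumes "a \<in> edges T"
  shows "depth a = Suc (depth (parent T a))"
proof -
  obtain k where "(parent T ^^ k) a = root T"
    using assms tree unfolding rooted_tree_def edges_def by auto
  moreover have "(parent T ^^ 0) a \<noteq> root T" using assms by (auto simp: edges_def)
  ultimately show ?thesis
    unfolding depth_def using Least_Suc[of "\<lambda>k. (parent T ^^ k) a = root T" k]
    by (simp add: funpow_swap1)
qed

lemma ancestors_root: "ancestors T (root T) = {root T}"
proof -
  have "(\<forall>j<k. (parent T ^^ j) (root T) \<noteq> root T) \<longleftrightarrow> k = 0" for k
    by (cases k) (auto dest: spec[of _ 0])
  then show ?thesis unfolding ancestors_def by simp
qed

lemma ancestors_edge:
  assumes "a \<in> edges T"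
  shows "ancestors T a = insert a (ancestors T (parent T a))"
proof -
  have "a \<noteq> root T" using assms by (simp add: edges_def)
  then have Suc: "(\<forall>j<Suc k. (parent T ^^ j) a \<noteq> root T) \<longleftrightarrow>
      (\<forall>j<k. (parent T ^^ j) (parent T a) \<noteq> root T)" for k
    by (auto simp: All_less_Suc2 funpow_swap1)
  have split: "(\<exists>k. Q k) \<longleftrightarrow> Q 0 \<or> (\<exists>k. Q (Suc k))" for Q
    by (metis not0_implies_Suc)
  have "b \<in> ancestors T a \<longleftrightarrow> b = a \<or> b \<in> ancestors T (parent T a)" for b
    unfolding ancestors_def mem_Collect_eq
    by (subst split) (simp add: Suc funpow_Suc_right del: funpow.simps(2))
  then show ?thesis by blast
qed

lemma verts_induct [consumes 1, case_names root edge]: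
  assumes "v \<in> verts T" and "P (root T)"
    and "\<And>a. a \<in> edges T \<Longrightarrow> P (parent T a) \<Longrightarrow> P a"
  shows "P v"
  using assms(1)
proof (induction "depth v" arbitrary: v rule: less_induct)
  case less
  show ?case
  proof (cases "v = root T")
    case False
    then have v: "v \<in> edges T" using less.prems by (simp add: edges_def)
    then have "P (parent T v)"
      by (intro less.hyps) (simp_all add: depth_edge parent_in_verts)
    with v show ?thesis by (rule assms(3))
  qed (use assms(2) in simp)
qed

lemma finite_ancestors: "v \<in> verts T \<Longrightarrow> finite (ancestors T v)"
  by (induction rule: verts_induct) (simp_all add: ancestors_root ancestors_edge)

lemma depth_ancestors: "v \<in> verts T \<Longrightarrow> \<forall>a\<in>ancestors T v. depth a \<le> depth v"
  by (induction rule: verts_induct) (auto simp: ancestors_root ancestors_edge depth_edge)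

lemma notin_ancestors_parent:
  assumes "a \<in> edges T"
  shows "a \<notin> ancestors T (parent T a)"
proof
  assume "a \<in> ancestors T (parent T a)"
  then have "depth a \<le> depth (parent T a)"
    using depth_ancestors parent_in_verts assms by blast
  then show False using assms by (simp add: depth_edge)
qed

text \<open>Induction from the leaves upwards. The path from the root to \<open>v\<close> determines
  both the class and the offset: at a leaf the offset of its label is the size of
  \<open>rank_set\<close>, and at the root no condition is left and the offset is 0.\<close>

lemma shatters_above:
  assumes shat: "ambiguous_shattered H T" and "r \<le> tree_rank T" and "v \<in> verts T"
  shows "shatters r
    {h \<in> H. \<forall>a\<in>ancestors T v - {root T}. ylab T a \<in> h (xlab T (parent T a))}
    (\<lambda>h. card {a \<in> ancestors T v - {root T}. a \<notin> edges0 T \<or>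
        (\<exists>b\<in>children T (parent T a). ylab T b \<notin> h (xlab T (parent T a)))})"
    (is "shatters r (?H v) (\<lambda>h. card (?M v h))")
  using assms(3)
proof (induction "Max (depth ` verts T) - depth v" arbitrary: v rule: less_induct)
  case less
  have fin: "finite (verts T)" using tree by (simp add: rooted_tree_def)
  show ?case
  proof (cases "v \<in> leaves T")
    case True
    have "r \<le> card (rank_set T v)"
      using True fin \<open>r \<le> tree_rank T\<close>
      by (auto simp: tree_rank_def leaves_def intro: order_trans)
    then have "r \<le> card (?M v (hlab T v))" by (simp add: rank_set_def)
    moreover have "hlab T v \<in> ?H v" using shat True unfolding ambiguous_shattered_def by blast
    ultimately show ?thesis by (rule shatters.leaf[rotated])
  next
    case False
    then have "card (children T v \<inter> edges0 T) = 1"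
      using shat less.prems by (auto simp: ambiguous_shattered_def inner_verts_def)
    then obtain c where c: "children T v \<inter> edges0 T = {c}" by (auto simp: card_1_singleton_iff)
    then have c': "c \<in> children T v" "c \<in> edges0 T" by auto
    let ?x = "xlab T v" and ?L = "ylab T ` children T v"
    \<comment> \<open>Passing to a child adds one condition to the class and, because
      \<open>a\<close> is new on the path, at most one to the count: exactly the terms of the rule
      \<open>node\<close>.\<close>
    have H_child: "?H a = {h \<in> ?H v. ylab T a \<in> h ?x}"
      and M_child: "card (?M a h) = card (?M v h) + of_bool (a \<notin> edges0 T \<or> \<not> ?L \<subseteq> h ?x)"
      and IH: "shatters r (?H a) (\<lambda>h. card (?M a h))"
      if a: "a \<in> children T v" for a h
    proof -
      have e: "a \<in> edges T" "parent T a = v" "a \<noteq> root T" "a \<in> verts T"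
        using a by (auto simp: children_def edges_def)
      have anc: "ancestors T a = insert a (ancestors T v)" "a \<notin> ancestors T v"
        using ancestors_edge notin_ancestors_parent e by auto
      show "?H a = {h \<in> ?H v. ylab T a \<in> h ?x}" using anc e by auto
      have "?M a h = (if a \<notin> edges0 T \<or> \<not> ?L \<subseteq> h ?x then insert a (?M v h) else ?M v h)"
        using anc e by auto
      moreover have "finite (?M v h)" "a \<notin> ?M v h"
        using finite_ancestors[OF less.prems] anc by auto
      ultimately show "card (?M a h) = card (?M v h) + of_bool (a \<notin> edges0 T \<or> \<not> ?L \<subseteq> h ?x)"
        by simp
      have "depth a \<le> Max (depth ` verts T)" using fin e by simp
      then show "shatters r (?H a) (\<lambda>h. card (?M a h))"
        using e depth_edge[of a] by (intro less.hyps) auto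
    qed
    show ?thesis
    proof (rule shatters.node[of "ylab T c" ?L _ _ ?x])
      show "ylab T c \<in> ?L" using c by auto
      show "shatters r {h \<in> ?H v. ylab T c \<in> h ?x} (\<lambda>h. card (?M v h) + of_bool (\<not> ?L \<subseteq> h ?x))"
        using IH[OF c'(1)] H_child[OF c'(1)] M_child[OF c'(1)] c'(2) by simp
      show "shatters r {h \<in> ?H v. y \<in> h ?x} (\<lambda>h. Suc (card (?M v h)))"
        if y: "y \<in> ?L" "y \<noteq> ylab T c" for y
      proof -
        obtain a where a: "a \<in> children T v" "y = ylab T a" using y by auto
        with y c have "a \<notin> edges0 T" by auto
        with IH[OF a(1)] H_child[OF a(1)] M_child[OF a(1)] a(2) show ?thesis by simp
      qed
    qed
  qed
qed

lemma shatters_of_tree: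
  assumes "ambiguous_shattered H T" and "r \<le> tree_rank T"
  shows "shatters r H (\<lambda>_. 0)"
proof -
  have "root T \<in> verts T" using tree by (simp add: rooted_tree_def)
  from shatters_above[OF assms this] show ?thesis by (simp add: ancestors_root)
qed

end

lemma shatters_of_AL_infinite:
  assumes "AL H = \<infinity>"
  shows "shatters r H (\<lambda>_. 0)"
proof -
  have "enat r < AL H" using assms by simp
  then obtain T :: "(nat, _, _) amb_tree" where "ambiguous_shattered H T" "r < tree_rank T"
    unfolding AL_def less_Sup_iff by auto
  then show ?thesis
    by (intro shatters_of_tree[of T]) (auto simp: ambiguous_shattered_def)
qed

section \<open>The mistake bound\<close>

text \<open>Repeating one admissible pair fills the word up; this is where a non-empty value of
  \<open>h\<close> enters.\<close>

lemma correct_word_extension: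
  assumes "h x \<noteq> {}" and "consistent h w" and "length w \<le> N"
  shows "\<exists>v. w @ v \<in> correct_words h N"
proof -
  obtain y where "y \<in> h x" using assms(1) by blast
  with assms(2,3) have "w @ replicate (N - length w) (x, y) \<in> correct_words h N"
    by (auto simp: correct_words_iff consistent_def)
  then show ?thesis by blast
qed

lemma finite_mistake_counts:
  "finite ((\<lambda>w. card (mistake_set A h w)) ` correct_words h N)"
  by (rule finite_subset[of _ "{..N}"]) (auto simp: correct_words_iff card_mistake_set_le)

lemma mistakes_hyp_le:
  assumes "\<exists>x. h x \<noteq> {}"
  shows "mistakes_hyp A h N \<le> N"
proof -
  from assms obtain x where "h x \<noteq> {}" ..
  then have "correct_words h N \<noteq> {}"
    using correct_word_extension[of h x "[]" N] by (auto simp: consistent_def)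
  then have "mistakes_hyp A h N \<in> (\<lambda>w. card (mistake_set A h w)) ` correct_words h N"
    unfolding mistakes_hyp_def by (intro Max_in finite_mistake_counts) auto
  then show ?thesis by (auto simp: correct_words_iff card_mistake_set_le)
qed

lemma finite_mistakes_hyp:
  assumes "\<And>h. h \<in> H \<Longrightarrow> \<exists>x. h x \<noteq> {}"
  shows "finite ((\<lambda>h. mistakes_hyp A h N) ` H)"
proof (rule finite_subset)
  show "(\<lambda>h. mistakes_hyp A h N) ` H \<subseteq> {..N}"
    by (intro image_subsetI atMost_iff[THEN iffD2] mistakes_hyp_le assms)
qed simp

lemma forces_le_mistakes_class:
  assumes "\<And>h. h \<in> H \<Longrightarrow> \<exists>x. h x \<noteq> {}" and "forces N d A H"
  shows "d \<le> mistakes_class A H N"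
proof -
  obtain h w where hw: "h \<in> H" "length w \<le> N" "consistent h w" "d \<le> card (mistake_set A h w)"
    using assms(2) unfolding forces_def by blast
  from assms(1)[OF hw(1)] obtain x where "h x \<noteq> {}" ..
  from correct_word_extension[OF this hw(3,2)] obtain v where v: "w @ v \<in> correct_words h N" ..
  have "d \<le> card (mistake_set A h (w @ v))" using hw by (simp add: card_mistake_set_append)
  also have "\<dots> \<le> mistakes_hyp A h N"
    unfolding mistakes_hyp_def by (rule Max_ge[OF finite_mistake_counts imageI[OF v]])
  also have "\<dots> \<le> mistakes_class A H N"
    unfolding mistakes_class_def
    by (rule Max_ge[OF finite_mistakes_hyp[OF assms(1)] imageI[OF hw(1)]])
  finally show ?thesis .
qed

lemma mistakes_class_le:
  assumes "H \<noteq> {}" and "\<And>h. h \<in> H \<Longrightarrow> \<exists>x. h x \<noteq> {}"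
  shows "mistakes_class A H N \<le> N"
proof -
  have "\<forall>h\<in>H. mistakes_hyp A h N \<le> N" by (intro ballI mistakes_hyp_le assms(2))
  with finite_mistakes_hyp[OF assms(2)] assms(1) show ?thesis
    unfolding mistakes_class_def by simp
qed

theorem corollary4p3:
  fixes H :: "('x \<Rightarrow> 'y::finite set) set"
  assumes "H \<noteq> {}"
    and "\<And>h. h \<in> H \<Longrightarrow> \<exists>x. h x \<noteq> {}"
    and "AL H = \<infinity>"
  shows "\<forall>N::nat. int (optimal_mistakes H N) \<ge> \<lfloor>sqrt (real N)\<rfloor>"
proof
  fix N :: nat
  define d where "d = nat \<lfloor>sqrt (real N)\<rfloor>"
  have d: "int d = \<lfloor>sqrt (real N)\<rfloor>" by (simp add: d_def)
  then have "real d \<le> sqrt (real N)" by linarith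
  then have "real d ^ 2 \<le> real N" using power_mono[of "real d" "sqrt (real N)" 2] by simp
  then have dN: "d * d \<le> N" by (simp add: power2_eq_square flip: of_nat_mult)
  have le: "d \<le> mistakes_class A H N" for A
  proof (rule forces_le_mistakes_class[OF assms(2)])
    have "forces (d * d) d A H"
      by (rule shatters_imp_forces[OF shatters_of_AL_infinite[OF assms(3)]])
    then obtain h w where "h \<in> H" "length w \<le> d * d" "consistent h w"
      "d \<le> card (mistake_set A h w)" unfolding forces_def by blast
    with dN show "forces N d A H"
      unfolding forces_def by (intro bexI[of _ h] exI[of _ w]) simp_all
  qed
  \<comment> \<open>\<open>Min\<close> is over all learners, possibly infinitely many; the bound
    \<open>N\<close> makes the set of values finite.\<close>
  have "range (\<lambda>A. mistakes_class A H N) \<subseteq> {..N}"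
    by (intro image_subsetI atMost_iff[THEN iffD2] mistakes_class_le assms(1,2))
  then have "finite (range (\<lambda>A. mistakes_class A H N))"
    by (rule finite_subset) simp
  then have "d \<le> optimal_mistakes H N"
    unfolding optimal_mistakes_def using le by (subst Min_ge_iff) simp_all
  with d show "\<lfloor>sqrt (real N)\<rfloor> \<le> int (optimal_mistakes H N)" by linarith
qed

end
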